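(* The Giry monad $\mathcal{G}$ on $\mathbf{Meas}$ is not strong with respect to the canonical symmetric monoidal closed structure $(\otimes, 1, \multimap)$ on $\mathbf{Meas}$.
   Context: $\mathbf{Meas}$ is the category of all measurable spaces and measurable functions. For a measurable space $X$, $|X|$ denotes its underlying set and $\Sigma_X$ its $\sigma$-algebra; $1$ is the one-point measurable space. Canonical symmetric monoidal closed structure $(\otimes,1,\multimap)$ on $\mathbf{Meas}$: for measurable spaces $X,Y$, and $x\in|X|$, $y\in|Y|$, let $\Gamma_x\colon |Y|\to|X|\times|Y|$, $\Gamma_x(y')=(x,y')$, and $\Gamma_y\colon|X|\to|X|\times|Y|$, $\Gamma_y(x')=(x',y)$. Then $X\otimes Y=(|X|\times|Y|,\Sigma_{X\otimes Y})$, where $\Sigma_{X\otimes Y}$ is the finest $\sigma$-algebra $\Sigma$ on $|X|\times|Y|$ such that all $\Gamma_x\colon Y\to(|X|\times|Y|,\Sigma)$ ($x\in|X|$) and all $\Gamma_y\colon X\to(|X|\times|Y|,\Sigma)$ ($y\in|Y|$) are measurable. On morphisms, $f\otimes g$ is the function $(x,y)\mapsto(f(x),g(y))$; the unit is $1$, and the associator, unitors and symmetry are the same underlying functions as for cartesian products of sets. The internal hom is $X\multimap Y=(\mathbf{Meas}(X,Y),\Sigma_{X\multimap Y})$, where $\Sigma_{X\multimap Y}$ is the $\sigma$-algebra generated by the sets $\{f\in\mathbf{Meas}(X,Y)\mid f(x)\in U\}$ for $x\in|X|$, $U\in\Sigma_Y$. Giry monad $\mathcal{G}$: $|\mathcal{G}X|$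 is the set of probability measures on $X$, and $\Sigma_{\mathcal{G}X}$ is the coarsest $\sigma$-algebra making every evaluation $\mathrm{ev}_A\colon\mathcal{G}X\to[0,1]$, $\nu\mapsto\nu(A)$ ($A\in\Sigma_X$), measurable, where $[0,1]$ has its Borel $\sigma$-algebra. For measurable $f\colon X\to Y$, $(\mathcal{G}f)(\mu)=\mu(f^{-1}(-))$. The unit is $\eta_X(x)=\delta_x$ (Dirac measure), and the Kleisli lifting of $f\colon X\to\mathcal{G}Y$ is $f^\sharp(\mu)(A)=\int_X f(-)(A)\,d\mu$. A monad $(T,\eta,\mu)$ is strong with respect to a symmetric monoidal category $(\mathbb{C},\otimes,I)$ if there is a tensorial strength, i.e. a natural transformation $\mathrm{st}_{X,Y}\colon X\otimes TY\to T(X\otimes Y)$ satisfying the usual coherence conditions with the left unitor, the associator, $\eta$ and $\mu$. For a symmetric monoidal closed category this is equivalent (Kock) to the existence of a strength, i.e. a family of morphisms $(X\multimap Y)\to(TX\multimap TY)$ making $T$ an enriched monad. *)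

theory Defs
  imports "HOL-Probability.Probability"
begin

text \<open>
  A measurable space is a value of type \<^typ>\<open>'a measure\<close> of which only \<^const>\<open>space\<close> and
  \<^const>\<open>sets\<close> matter: two values with the same space and sets are isomorphic via the identity.
  The Giry monad is the library's: \<^const>\<open>prob_algebra\<close> on objects,
  \<open>\<lambda>\<mu>. distr \<mu> Y f\<close> on morphisms, \<^const>\<open>return\<close> as unit, and
  \<open>\<lambda>\<mu>. \<mu> \<bind> f\<close> as Kleisli lifting of \<open>f\<close>; in particular \<open>\<lambda>M. M \<bind> (\<lambda>\<nu>. \<nu>)\<close> is the
  monad multiplication.
\<close>

definition tensor :: "'a measure \<Rightarrow> 'b measure \<Rightarrow> ('a \<times> 'b) measure"  (infixr \<open>\<otimes>\<^sub>s\<close> 80) where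
  "X \<otimes>\<^sub>s Y = sigma (space X \<times> space Y)
     {A. A \<subseteq> space X \<times> space Y
       \<and> (\<forall>x\<in>space X. (\<lambda>y. (x, y)) -` A \<inter> space Y \<in> sets Y)
       \<and> (\<forall>y\<in>space Y. (\<lambda>x. (x, y)) -` A \<inter> space X \<in> sets X)}"

abbreviation one_space :: "unit measure" where
  "one_space \<equiv> count_space UNIV"

lemma space_tensor: "space (X \<otimes>\<^sub>s Y) = space X \<times> space Y"
  unfolding tensor_def by (intro space_measure_of) auto

lemma sets_tensor:
  "sets (X \<otimes>\<^sub>s Y) =
     {A. A \<subseteq> space X \<times> space Y
       \<and> (\<forall>x\<in>space X. (\<lambda>y. (x, y)) -` A \<inter> space Y \<in> sets Y)
       \<and> (\<forall>y\<in>space Y. (\<lambda>x. (x, y)) -` A \<inter> space X \<in> sets X)}"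
    (is "_ = ?S")
proof -
  have "sigma_algebra (space X \<times> space Y) ?S"
  proof (unfold sigma_algebra_iff2, intro conjI ballI allI impI, goal_cases)
    case (3 A)
    have "(\<lambda>y. (x, y)) -` (space X \<times> space Y - A) \<inter> space Y
            = space Y - ((\<lambda>y. (x, y)) -` A \<inter> space Y)" if "x \<in> space X" for x
      using that by auto
    moreover have "(\<lambda>x. (x, y)) -` (space X \<times> space Y - A) \<inter> space X
            = space X - ((\<lambda>x. (x, y)) -` A \<inter> space X)" if "y \<in> space Y" for y
      using that by auto
    ultimately show ?case using 3 by auto
  next
    case (4 A)
    have "(\<lambda>y. (x, y)) -` (\<Union>i. A i) \<inter> space Y = (\<Union>i. (\<lambda>y. (x, y)) -` A i \<inter> space Y)" for x
      by auto
    moreover have "(\<lambda>x. (x, y)) -` (\<Union>i. A i) \<inter> space X = (\<Union>i. (\<lambda>x. (x, y)) -` A i \<inter> space X)" for y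
      by auto
    moreover have "(\<Union>i. (\<lambda>y. (x, y)) -` A i \<inter> space Y) \<in> sets Y" if "x \<in> space X" for x
      using that 4 by (intro sets.countable_UN) blast
    moreover have "(\<Union>i. (\<lambda>x. (x, y)) -` A i \<inter> space X) \<in> sets X" if "y \<in> space Y" for y
      using that 4 by (intro sets.countable_UN) blast
    moreover have "(\<Union>i. A i) \<subseteq> space X \<times> space Y"
      using 4 by blast
    ultimately show ?case by simp
  qed auto
  then show ?thesis
    unfolding tensor_def by (rule sigma_algebra.sets_measure_of_eq)
qed

text \<open>The defining universal property of the tensor \<open>\<sigma>\<close>-algebra: the finest one making
  all sections measurable.\<close>

lemma measurable_tensor_sections:
  "x \<in> space X \<Longrightarrow> (\<lambda>y. (x, y)) \<in> Y \<rightarrow>\<^sub>M X \<otimes>\<^sub>s Y"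
  "y \<in> space Y \<Longrightarrow> (\<lambda>x. (x, y)) \<in> X \<rightarrow>\<^sub>M X \<otimes>\<^sub>s Y"
  by (auto simp: measurable_def space_tensor sets_tensor)

lemma tensor_finest:
  assumes "space N = space X \<times> space Y"
    and "\<And>x. x \<in> space X \<Longrightarrow> (\<lambda>y. (x, y)) \<in> Y \<rightarrow>\<^sub>M N"
    and "\<And>y. y \<in> space Y \<Longrightarrow> (\<lambda>x. (x, y)) \<in> X \<rightarrow>\<^sub>M N"
  shows "sets N \<subseteq> sets (X \<otimes>\<^sub>s Y)"
proof
  fix A assume A: "A \<in> sets N"
  have "A \<subseteq> space X \<times> space Y"
    using sets.sets_into_space[OF A] assms(1) by simp
  with A show "A \<in> sets (X \<otimes>\<^sub>s Y)"
    using assms(2,3) by (auto simp: sets_tensor dest: measurable_sets)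
qed

definition meas_iso :: "'a measure \<Rightarrow> 'b measure \<Rightarrow> ('a \<Rightarrow> 'b) \<Rightarrow> bool" where
  "meas_iso X Y f \<longleftrightarrow> f \<in> X \<rightarrow>\<^sub>M Y \<and> bij_betw f (space X) (space Y)
     \<and> the_inv_into (space X) f \<in> Y \<rightarrow>\<^sub>M X"

text \<open>
  \<open>Ob\<close> is the class of objects of a full subcategory of \<open>Meas\<close>, whose objects have carriers
  inside one type \<open>'u\<close>. The spaces \<open>1\<close>, \<open>X \<otimes> Y\<close> and \<open>\<G> Y\<close> live on other types, so they
  are objects only up to isomorphism. Given isomorphisms \<open>p : A \<cong> P\<close> and \<open>q : B \<cong> Q\<close> with
  \<open>P, Q \<in> Ob\<close>, the component of \<open>st\<close> at \<open>A\<close>, \<open>B\<close> is the one at \<open>P\<close>, \<open>Q\<close> transported back: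
  \<open>\<G>(p\<inverse> \<otimes> q\<inverse>) \<circ> st\<^sub>P\<^sub>,\<^sub>Q \<circ> (p \<otimes> \<G> q)\<close>. By naturality it does not depend on the representatives.
\<close>

type_synonym 'u strength = "'u measure \<Rightarrow> 'u measure \<Rightarrow> 'u \<times> 'u measure \<Rightarrow> ('u \<times> 'u) measure"

definition transport ::
  "'u strength \<Rightarrow> 'a measure \<Rightarrow> ('a \<Rightarrow> 'u) \<Rightarrow> 'u measure \<Rightarrow> 'b measure \<Rightarrow> ('b \<Rightarrow> 'u) \<Rightarrow> 'u measure
     \<Rightarrow> 'a \<times> 'b measure \<Rightarrow> ('a \<times> 'b) measure" where
  "transport st A p P B q Q =
     (\<lambda>(a, \<nu>). distr (st P Q (p a, distr \<nu> Q q)) (A \<otimes>\<^sub>s B)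
        (map_prod (the_inv_into (space A) p) (the_inv_into (space B) q)))"

text \<open>
  When \<open>Ob\<close> is closed, up to isomorphism, under \<open>1\<close>, \<open>\<otimes>\<close> and \<open>\<G>\<close> (for instance, all spaces
  that are small relative to a Grothendieck universe), the following are exactly the axioms of a
  tensorial strength. For other \<open>Ob\<close>, a diagram is required to commute whenever all objects at
  which it uses \<open>st\<close> are isomorphic to members of \<open>Ob\<close>; so the restriction to \<open>Ob\<close> of a tensorial
  strength on all of \<open>Meas\<close> is always one in this sense.
\<close>

locale tensorial_strength =
  fixes Ob :: "'u measure set" and st :: "'u strength"
  assumes component:
    "\<lbrakk>X \<in> Ob; Y \<in> Ob\<rbrakk> \<Longrightarrow> st X Y \<in> X \<otimes>\<^sub>s prob_algebra Y \<rightarrow>\<^sub>M prob_algebra (X \<otimes>\<^sub>s Y)"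
  and naturality:
    "\<lbrakk>X \<in> Ob; X' \<in> Ob; Y \<in> Ob; Y' \<in> Ob; f \<in> X \<rightarrow>\<^sub>M X'; g \<in> Y \<rightarrow>\<^sub>M Y';
      x \<in> space X; \<nu> \<in> space (prob_algebra Y)\<rbrakk> \<Longrightarrow>
      distr (st X Y (x, \<nu>)) (X' \<otimes>\<^sub>s Y') (map_prod f g) = st X' Y' (f x, distr \<nu> Y' g)"
  and left_unitor:
    "\<lbrakk>Y \<in> Ob; I \<in> Ob; meas_iso one_space I i; \<nu> \<in> space (prob_algebra Y)\<rbrakk> \<Longrightarrow>
      distr (transport st one_space i I Y id Y ((), \<nu>)) Y snd = \<nu>"
  and associator:
    "\<lbrakk>X \<in> Ob; Y \<in> Ob; Z \<in> Ob; P \<in> Ob; Q \<in> Ob; meas_iso (X \<otimes>\<^sub>s Y) P p; meas_iso (Y \<otimes>\<^sub>s Z) Q q;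
      x \<in> space X; y \<in> space Y; \<nu> \<in> space (prob_algebra Z)\<rbrakk> \<Longrightarrow>
      distr (transport st (X \<otimes>\<^sub>s Y) p P Z id Z ((x, y), \<nu>)) (X \<otimes>\<^sub>s (Y \<otimes>\<^sub>s Z))
        (\<lambda>((a, b), c). (a, (b, c)))
      = transport st X id X (Y \<otimes>\<^sub>s Z) q Q (x, st Y Z (y, \<nu>))"
  and unit:
    "\<lbrakk>X \<in> Ob; Y \<in> Ob; x \<in> space X; y \<in> space Y\<rbrakk> \<Longrightarrow>
      st X Y (x, return Y y) = return (X \<otimes>\<^sub>s Y) (x, y)"
  and multiplication:
    "\<lbrakk>X \<in> Ob; Y \<in> Ob; G \<in> Ob; meas_iso (prob_algebra Y) G g\<^sub>Y;
      x \<in> space X; M \<in> space (prob_algebra (prob_algebra Y))\<rbrakk> \<Longrightarrow>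
      st X Y (x, M \<bind> (\<lambda>\<nu>. \<nu>))
      = distr (transport st X id X (prob_algebra Y) g\<^sub>Y G (x, M)) (prob_algebra (X \<otimes>\<^sub>s Y)) (st X Y)
          \<bind> (\<lambda>\<rho>. \<rho>)"

text \<open>The Giry monad, on the full subcategory with objects \<open>Ob\<close>, admits a tensorial strength.\<close>

definition giry_strong :: "'u measure set \<Rightarrow> bool" where
  "giry_strong Ob \<longleftrightarrow> (\<exists>st. tensorial_strength Ob st)"

end

theory Submission
  imports Defs
begin

text \<open>
  The axioms leave no choice for a tensorial strength. Since \<open>x : 1 \<rightarrow> X\<close> is a morphism for every
  point \<open>x\<close> of \<open>X\<close>, naturality and the left unitor force \<open>st\<^sub>X\<^sub>,\<^sub>Y (x, \<nu>)\<close> to be the image of \<open>\<nu>\<close>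
  under \<open>y \<mapsto> (x, y)\<close> (\<open>emeasure_strength\<close>). A strength is moreover measurable on \<open>X \<otimes> \<G> Y\<close>, hence
  measurable in \<open>x\<close> for fixed \<open>\<nu>\<close>. So, if a strength exists, \<open>x \<mapsto> \<nu> (A\<^sub>x)\<close> is measurable for every
  \<open>A \<in> \<Sigma>\<^bsub>X \<otimes> Y\<^esub>\<close>, where \<open>A\<^sub>x\<close> denotes the section of \<open>A\<close> at \<open>x\<close> (\<open>measurable_emeasure_section\<close>).
  This is a weak form of Fubini's theorem, and it is false for the tensor, because membership in
  \<open>\<Sigma>\<^bsub>X \<otimes> Y\<^esub>\<close> only constrains the sections of \<open>A\<close> one at a time.

  The counterexample is of Sierpinski's type. Let \<open>T\<close> be an uncountable set with a total order all
  of whose initial segments are countable, such as \<open>\<omega>\<^sub>1\<close>; every uncountable set has a subset of this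
  kind (\<open>exists_countable_initial_segments\<close>). Let \<open>X = Y = T\<close> with the \<open>\<sigma>\<close>-algebra of countable and
  cocountable sets, and let \<open>\<nu>\<close> be the measure that is 0 on the countable and 1 on the other
  measurable sets. Choose \<open>B \<subseteq> T\<close> uncountable with uncountable complement, so that \<open>B\<close> is not
  measurable, and put \<open>A = {(x, y). x \<in> B \<and> x \<le> y}\<close>. The section of \<open>A\<close> at \<open>x\<close> is cocountable
  if \<open>x \<in> B\<close> and empty otherwise, while the section at any \<open>y\<close> is contained in an initial segment and
  therefore countable. Thus \<open>A\<close> belongs to \<open>\<Sigma>\<^bsub>X \<otimes> Y\<^esub>\<close>, but \<open>x \<mapsto> \<nu> (A\<^sub>x)\<close> is the indicator
  function of \<open>B\<close>.
\<close>

section \<open>Uncountable sets\<close>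

text \<open>
  Any well-order of \<open>S\<close> either has only countable proper initial segments, or it has a least point
  with an uncountable one, and that segment is the required subset.
\<close>

lemma exists_countable_initial_segments:
  fixes S :: "'a set"
  assumes "uncountable S"
  obtains T r where "T \<subseteq> S" "uncountable T"
    and "\<And>x y. x \<in> T \<Longrightarrow> y \<in> T \<Longrightarrow> (x, y) \<in> r \<or> (y, x) \<in> r"
    and "\<And>y. y \<in> T \<Longrightarrow> countable {x\<in>T. (x, y) \<in> r}"
proof -
  obtain r where r: "well_order_on S r"
    using well_order_on by blast
  have wf: "wf (r - Id)" and tot: "total_on S r" and refl: "refl_on S r"
    using r by (auto simp: well_order_on_def linear_order_on_def partial_order_on_def
        preorder_on_def)
  have total: "(x, y) \<in> r \<or> (y, x) \<in> r" if "x \<in> S" "y \<in> S" for x y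
    using tot refl that by (cases "x = y") (auto simp: total_on_def refl_on_def)
  define U where "U = {y\<in>S. uncountable {x\<in>S. (x, y) \<in> r}}"
  show ?thesis
  proof (cases "U = {}")
    case True
    then show ?thesis
      using assms total by (intro that[of S r]) (auto simp: U_def)
  next
    case False
    then obtain m where m: "m \<in> U" and min: "\<And>y. (y, m) \<in> r - Id \<Longrightarrow> y \<notin> U"
      using wf unfolding wf_eq_minimal by (metis ex_in_conv)
    define T where "T = {x\<in>S. (x, m) \<in> r} - {m}"
    show ?thesis
    proof (rule that)
      show "T \<subseteq> S"
        by (auto simp: T_def)
      then show "(x, y) \<in> r \<or> (y, x) \<in> r" if "x \<in> T" "y \<in> T" for x y
        using total that by blast
      show "uncountable T"
        using m by (auto simp: T_def U_def)
      show "countable {x\<in>T. (x, y) \<in> r}" if "y \<in> T" for y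
      proof -
        have "y \<notin> U" "y \<in> S"
          using that min[of y] by (auto simp: T_def)
        then have "countable {x\<in>S. (x, y) \<in> r}"
          by (auto simp: U_def)
        then show ?thesis
          by (rule countable_subset[rotated]) (auto simp: T_def)
      qed
    qed
  qed
qed

text \<open>An infinite set is equipotent to the disjoint sum of two copies of itself.\<close>

lemma uncountable_split:
  includes cardinal_syntax
  assumes "uncountable T"
  shows "\<exists>B\<subseteq>T. uncountable B \<and> uncountable (T - B)"
proof -
  have "infinite T"
    using assms countable_finite by blast
  then have "|T <+> T| =o |T|"
    by (rule card_of_Plus_infinite1[OF _ ordLeq_refl[OF card_of_Card_order]])
  then obtain f where f: "bij_betw f (T <+> T) T"
    using card_of_ordIso by blast
  then have inj: "inj_on f (T <+> T)"
    by (rule bij_betw_imp_inj_on)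
  have "inj_on (f \<circ> Inl) T" "inj_on (f \<circ> Inr) T"
    using inj by (auto simp: inj_on_def)
  then have "uncountable (f ` Inl ` T)" "uncountable (f ` Inr ` T)"
    using assms countable_image_inj_on by (metis image_comp)+
  moreover have "f ` Inr ` T \<subseteq> T - f ` Inl ` T" "f ` Inl ` T \<subseteq> T"
    using f inj by (auto simp: bij_betw_def inj_on_def)
  ultimately show ?thesis
    by (meson countable_subset)
qed

section \<open>The countable-cocountable measure\<close>

definition cocountable_measure :: "'a set \<Rightarrow> 'a measure" where
  "cocountable_measure T =
     measure_of T {A. A \<subseteq> T \<and> (countable A \<or> countable (T - A))} (\<lambda>A. if countable A then 0 else 1)"

lemma sigma_algebra_cocountable:
  "sigma_algebra T {A. A \<subseteq> T \<and> (countable A \<or> countable (T - A))}"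
proof (unfold sigma_algebra_iff2, intro conjI ballI allI impI, goal_cases)
  case (3 A)
  then show ?case
    by (auto simp: double_diff)
next
  case (4 A)
  show ?case
  proof (cases "\<forall>i. countable (A i)")
    case False
    then obtain i where "countable (T - A i)"
      using 4 by blast
    then have "countable (T - (\<Union>i. A i))"
      by (rule countable_subset[rotated]) auto
    then show ?thesis
      using 4 by blast
  qed (use 4 in auto)
qed auto

lemma space_cocountable_measure: "space (cocountable_measure T) = T"
  unfolding cocountable_measure_def by (intro space_measure_of) auto

lemma sets_cocountable_measure:
  "sets (cocountable_measure T) = {A. A \<subseteq> T \<and> (countable A \<or> countable (T - A))}"
  unfolding cocountable_measure_def by (rule sigma_algebra.sets_measure_of_eq[OF sigma_algebra_cocountable])

text \<open>
  Countable additivity rests on the fact that two disjoint subsets of an uncountable set cannot both be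
  cocountable, so at most one member of a disjoint family has measure 1.
\<close>

lemma emeasure_cocountable_measure:
  assumes "uncountable T" and A: "A \<in> sets (cocountable_measure T)"
  shows "emeasure (cocountable_measure T) A = (if countable A then 0 else 1)"
proof (unfold cocountable_measure_def, rule emeasure_measure_of_sigma[OF sigma_algebra_cocountable])
  let ?S = "{A. A \<subseteq> T \<and> (countable A \<or> countable (T - A))}"
  let ?\<mu> = "\<lambda>A::'a set. if countable A then 0 else (1::ennreal)"
  show "positive ?S ?\<mu>"
    by (simp add: positive_def)
  show "A \<in> ?S"
    using A by (simp add: sets_cocountable_measure)
  show "countably_additive ?S ?\<mu>"
  proof (rule countably_additiveI)
    fix F :: "nat \<Rightarrow> 'a set"
    assume F: "range F \<subseteq> ?S" and disj: "disjoint_family F"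
    show "(\<Sum>i. ?\<mu> (F i)) = ?\<mu> (\<Union>i. F i)"
    proof (cases "\<forall>i. countable (F i)")
      case True
      then show ?thesis by simp
    next
      case False
      then obtain i where i: "uncountable (F i)" by blast
      have "countable (F j)" if "j \<noteq> i" for j
      proof -
        have "F j \<inter> F i = {}"
          using disj that by (simp add: disjoint_family_on_def)
        then have "F j \<subseteq> T - F i"
          using F by blast
        moreover have "countable (T - F i)"
          using F i by blast
        ultimately show ?thesis
          by (rule countable_subset)
      qed
      then have "(\<lambda>j. ?\<mu> (F j)) = (\<lambda>j. if j = i then 1 else 0)"
        using i by auto
      moreover have "(\<lambda>j. if j = i then 1 else 0) sums (1::ennreal)"
        by (rule sums_single)
      ultimately have "(\<Sum>j. ?\<mu> (F j)) = 1"
        by (simp add: sums_iff)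
      moreover have "uncountable (\<Union>i. F i)"
        using i countable_subset[of "F i" "\<Union>i. F i"] by blast
      ultimately show ?thesis
        by simp
    qed
  qed
qed

lemma prob_space_cocountable_measure:
  assumes "uncountable T"
  shows "prob_space (cocountable_measure T)"
proof
  have "T \<in> sets (cocountable_measure T)"
    by (simp add: sets_cocountable_measure)
  then show "emeasure (cocountable_measure T) (space (cocountable_measure T)) = 1"
    using assms by (simp add: emeasure_cocountable_measure space_cocountable_measure)
qed

section \<open>Uniqueness and measurability of a tensorial strength\<close>

text \<open>
  The space \<open>I\<close> plays the part of the monoidal unit: naturality along \<open>s \<mapsto> x\<close> reduces the
  component at \<open>X\<close> to the component at \<open>I\<close>, and the second marginal of the latter is \<open>\<nu>\<close> by the
  left unitor. As \<open>I\<close> has only one point, a measure on \<open>I \<otimes> Y\<close> is determined by that marginal.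
\<close>

lemma (in tensorial_strength) emeasure_strength:
  assumes X: "X \<in> Ob" and Y: "Y \<in> Ob" and I: "count_space {s} \<in> Ob"
    and x: "x \<in> space X" and \<nu>: "\<nu> \<in> space (prob_algebra Y)"
    and A: "A \<in> sets (X \<otimes>\<^sub>s Y)"
  shows "emeasure (st X Y (x, \<nu>)) A = emeasure \<nu> {y \<in> space Y. (x, y) \<in> A}"
proof -
  let ?I = "count_space {s}"
  let ?L = "st ?I Y (s, \<nu>)"
  let ?A = "{y \<in> space Y. (x, y) \<in> A}"
  have sets_\<nu>: "sets \<nu> = sets Y"
    using \<nu> by (simp add: space_prob_algebra)
  have distr_\<nu>: "distr \<nu> Y (\<lambda>y. y) = \<nu>"
    using sets_\<nu> by (simp add: distr_id2)
  have "(s, \<nu>) \<in> space (?I \<otimes>\<^sub>s prob_algebra Y)"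
    using \<nu> by (simp add: space_tensor)
  then have "?L \<in> space (prob_algebra (?I \<otimes>\<^sub>s Y))"
    by (rule measurable_space[OF component[OF I Y]])
  then have sets_L: "sets ?L = sets (?I \<otimes>\<^sub>s Y)"
    by (simp add: space_prob_algebra)
  have space_L: "space ?L = {s} \<times> space Y"
    using sets_eq_imp_space_eq[OF sets_L] by (simp add: space_tensor)
  have A_sec: "?A \<in> sets Y"
    using A x by (auto simp: sets_tensor vimage_def Int_def conj_commute)

  \<comment> \<open>Naturality along \<open>s \<mapsto> x\<close> moves the question from \<open>X\<close> to \<open>I\<close>.\<close>
  have "st X Y (x, \<nu>) = distr ?L (X \<otimes>\<^sub>s Y) (map_prod (\<lambda>_. x) (\<lambda>y. y))"
    using naturality[OF I X Y Y, of "\<lambda>_. x" "\<lambda>y. y" s \<nu>] x \<nu> distr_\<nu> by simp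
  moreover have "map_prod (\<lambda>_. x) (\<lambda>y. y) \<in> ?L \<rightarrow>\<^sub>M X \<otimes>\<^sub>s Y"
    unfolding measurable_cong_sets[OF sets_L refl]
    using x by (auto simp: measurable_def space_tensor sets_tensor vimage_def Int_def conj_commute)
  ultimately have "emeasure (st X Y (x, \<nu>)) A
      = emeasure ?L (map_prod (\<lambda>_. x) (\<lambda>y. y) -` A \<inter> space ?L)"
    using A by (simp add: emeasure_distr)
  also have "map_prod (\<lambda>_. x) (\<lambda>y. y) -` A \<inter> space ?L = {s} \<times> ?A"
    by (auto simp: space_L)
  finally have *: "emeasure (st X Y (x, \<nu>)) A = emeasure ?L ({s} \<times> ?A)" .

  \<comment> \<open>The left unitor speaks of \<open>1\<close> itself, so \<open>I\<close> is identified with \<open>1\<close> along \<open>?i\<close>; the map \<open>?m\<close>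
    is the resulting isomorphism from \<open>I \<otimes> Y\<close> to \<open>1 \<otimes> Y\<close>.\<close>
  let ?i = "\<lambda>_::unit. s"
  let ?m = "map_prod (the_inv_into UNIV ?i) (the_inv_into (space Y) id)"
  have iso: "meas_iso one_space ?I ?i"
    by (auto simp: meas_iso_def bij_betw_def inj_on_def)
  have id_inv: "the_inv_into (space Y) id y = y" if "y \<in> space Y" for y
    using the_inv_into_f_f[of id "space Y" y] that by simp
  have m: "?m \<in> ?L \<rightarrow>\<^sub>M one_space \<otimes>\<^sub>s Y"
  proof (rule measurableI)
    fix C
    assume "C \<in> sets (one_space \<otimes>\<^sub>s Y)"
    then have "{y \<in> space Y. ((), y) \<in> C} \<in> sets Y"
      by (auto simp: sets_tensor vimage_def Int_def conj_commute)
    moreover have "?m -` C \<inter> space ?L = {s} \<times> {y \<in> space Y. ((), y) \<in> C}"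
      by (auto simp: space_L id_inv)
    ultimately show "?m -` C \<inter> space ?L \<in> sets ?L"
      by (auto simp: sets_L sets_tensor)
  qed (auto simp: space_L space_tensor id_inv)
  have snd: "snd \<in> (one_space \<otimes>\<^sub>s Y) \<rightarrow>\<^sub>M Y"
    by (auto simp: measurable_def space_tensor sets_tensor vimage_def Int_def conj_commute)
  have "\<nu> = distr (distr ?L (one_space \<otimes>\<^sub>s Y) ?m) Y snd"
    using left_unitor[OF Y I iso \<nu>] distr_\<nu> by (simp add: transport_def id_def)
  also have "\<dots> = distr ?L Y (snd \<circ> ?m)"
    by (rule distr_distr[OF snd m])
  finally have "emeasure \<nu> ?A = emeasure ?L ((snd \<circ> ?m) -` ?A \<inter> space ?L)"
    using emeasure_distr[OF measurable_comp[OF m snd] A_sec] by simp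
  also have "(snd \<circ> ?m) -` ?A \<inter> space ?L = {s} \<times> ?A"
    by (auto simp: space_L id_inv)
  finally show ?thesis
    using * by simp
qed

text \<open>
  Sections \<open>x \<mapsto> (x, \<nu>)\<close> into a tensor are measurable, so the strength is measurable in \<open>x\<close> alone.
\<close>

lemma (in tensorial_strength) measurable_emeasure_section:
  assumes X: "X \<in> Ob" and Y: "Y \<in> Ob" and I: "count_space {s} \<in> Ob"
    and \<nu>: "\<nu> \<in> space (prob_algebra Y)" and A: "A \<in> sets (X \<otimes>\<^sub>s Y)"
  shows "(\<lambda>x. emeasure \<nu> {y \<in> space Y. (x, y) \<in> A}) \<in> borel_measurable X"
proof -
  have "(\<lambda>x. st X Y (x, \<nu>)) \<in> X \<rightarrow>\<^sub>M prob_algebra (X \<otimes>\<^sub>s Y)"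
    using measurable_compose[OF measurable_tensor_sections(2)[OF \<nu>] component[OF X Y]] .
  then have "(\<lambda>x. emeasure (st X Y (x, \<nu>)) A) \<in> borel_measurable X"
    using measurable_compose[OF measurable_prob_algebraD measurable_emeasure_subprob_algebra[OF A]]
    by blast
  then show ?thesis
    by (rule measurable_cong[THEN iffD1, rotated]) (rule emeasure_strength[OF X Y I _ \<nu> A])
qed

section \<open>The counterexample\<close>

text \<open>
  All sections of \<open>A\<close> below are countable or cocountable, but which of the two holds for the
  section at \<open>x\<close> depends on whether \<open>x\<close> lies in the set \<open>B\<close>, which is not measurable.
\<close>

lemma nonmeasurable_emeasure_section:
  assumes unc: "uncountable T"
    and total: "\<And>x y. x \<in> T \<Longrightarrow> y \<in> T \<Longrightarrow> (x, y) \<in> r \<or> (y, x) \<in> r"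
    and seg: "\<And>y. y \<in> T \<Longrightarrow> countable {x\<in>T. (x, y) \<in> r}"
  defines "M \<equiv> cocountable_measure T"
  shows "\<exists>A \<in> sets (M \<otimes>\<^sub>s M). (\<lambda>x. emeasure M {y \<in> space M. (x, y) \<in> A}) \<notin> borel_measurable M"
proof -
  obtain B where B: "B \<subseteq> T" "uncountable B" "uncountable (T - B)"
    using uncountable_split[OF unc] by blast
  have space_M: "space M = T"
    by (simp add: M_def space_cocountable_measure)
  define A where "A = {(x, y). x \<in> B \<and> y \<in> T \<and> (x, y) \<in> r}"
  have upper: "countable (T - {y\<in>T. (x, y) \<in> r})" if "x \<in> T" for x
    using total[OF that] by (intro countable_subset[OF _ seg[OF that]]) auto
  have section_x: "{y\<in>T. (x, y) \<in> A} = (if x \<in> B then {y\<in>T. (x, y) \<in> r} else {})" for x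
    by (auto simp: A_def)
  have "countable {x\<in>T. (x, y) \<in> A}" if "y \<in> T" for y
    by (rule countable_subset[OF _ seg[OF that]]) (auto simp: A_def)
  moreover have "{y\<in>T. (x, y) \<in> A} \<in> sets M" if "x \<in> T" for x
    using upper[OF that] unfolding section_x by (auto simp: M_def sets_cocountable_measure)
  moreover have "A \<subseteq> T \<times> T"
    using B by (auto simp: A_def)
  ultimately have A: "A \<in> sets (M \<otimes>\<^sub>s M)"
    by (auto simp: sets_tensor space_cocountable_measure M_def sets_cocountable_measure vimage_def Int_def conj_commute)
  have "uncountable {y\<in>T. (x, y) \<in> r}" if "x \<in> T" for x
    using uncountable_minus_countable[OF unc upper[OF that]] by (simp add: double_diff)
  then have indicator: "emeasure M {y\<in>T. (x, y) \<in> A} = (if x \<in> B then 1 else 0)" if "x \<in> T" for x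
    using upper[OF that] that unfolding section_x M_def
    by (simp add: emeasure_cocountable_measure[OF unc] sets_cocountable_measure)
  have "(\<lambda>x. emeasure M {y \<in> space M. (x, y) \<in> A}) \<notin> borel_measurable M"
  proof
    assume "(\<lambda>x. emeasure M {y \<in> space M. (x, y) \<in> A}) \<in> borel_measurable M"
    then have "(\<lambda>x. emeasure M {y \<in> space M. (x, y) \<in> A}) -` {1} \<inter> space M \<in> sets M"
      by (rule measurable_sets) simp
    also have "(\<lambda>x. emeasure M {y \<in> space M. (x, y) \<in> A}) -` {1} \<inter> space M = B"
      using B by (auto simp: space_M indicator split: if_splits)
    finally show False
      using B by (simp add: M_def sets_cocountable_measure)
  qed
  with A show ?thesis ..
qed

theorem theorem1:
  fixes Ob :: "'u measure set" and S :: "'u set"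
  assumes "uncountable S"
    and "\<And>X. space X \<subseteq> S \<Longrightarrow> X \<in> Ob"
  shows "\<not> giry_strong Ob"
proof
  assume "giry_strong Ob"
  then obtain st where "tensorial_strength Ob st"
    by (auto simp: giry_strong_def)
  then interpret tensorial_strength Ob st .
  from assms(1) show False
  proof (rule exists_countable_initial_segments)
    fix T r
    assume T: "T \<subseteq> S" "uncountable T"
      and order: "\<And>x y. x \<in> T \<Longrightarrow> y \<in> T \<Longrightarrow> (x, y) \<in> r \<or> (y, x) \<in> r"
        "\<And>y. y \<in> T \<Longrightarrow> countable {x\<in>T. (x, y) \<in> r}"
    \<comment> \<open>Values of the measure type carry a measure, so \<open>M\<close> serves as \<open>X\<close>, as \<open>Y\<close> and as \<open>\<nu>\<close>.\<close>
    let ?M = "cocountable_measure T"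
    have "S \<noteq> {}"
      using assms(1) by auto
    then obtain s where "s \<in> S"
      by blast
    then have I: "count_space {s} \<in> Ob"
      by (intro assms(2)) simp
    have M: "?M \<in> Ob"
      using T by (intro assms(2)) (simp add: space_cocountable_measure)
    have "?M \<in> space (prob_algebra ?M)"
      using prob_space_cocountable_measure[OF T(2)] by (simp add: space_prob_algebra)
    from measurable_emeasure_section[OF M M I this]
      nonmeasurable_emeasure_section[OF T(2) order]
    show False
      by blast
  qed
qed

end
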